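(* Let $\lambda$ and $\mu$ be partitions of lengths $r_1$ and $r_2$, let $r=r_1+r_2$, and let $\alpha\in\mathbb{R}$ with $\alpha+r>-1$. For $n\in\mathbb{N}_{\lambda,\mu}$ let $N(n)$ denote the number of zeros of the exceptional Laguerre polynomial $L^{(\alpha)}_{\lambda,\mu,n}$ in $(0,\infty)$, counted with multiplicity. Then for every $n\in\mathbb{N}_{\lambda,\mu}$, $$ n-2(|\lambda|+|\mu|)-r_2 \leq N(n). $$ Moreover, the number of simple zeros of $L^{(\alpha)}_{\lambda,\mu,n}$ in $(0,\infty)$ tends to infinity as $n\to\infty$ (with $n\in\mathbb{N}_{\lambda,\mu}$).
   Context: For $\alpha\in\mathbb{R}$ and an integer $n\ge 0$, $L^{(\alpha)}_n(x)=\frac{e^x x^{-\alpha}}{n!}\frac{d^n}{dx^n}\left(e^{-x}x^{n+\alpha}\right)$ is the Laguerre polynomial of degree $n$ (so $L_n^{(\alpha)}(x)=\sum_{k=0}^n\binom{n+\alpha}{n-k}\frac{(-x)^k}{k!}$). For sufficiently differentiable functions, $\mathrm{Wr}[f_1,\dots,f_r]=\det\left(\frac{d^{j-1}}{dx^{j-1}}f_i\right)_{1\le i,j\le r}$ is the Wronskian (the empty Wronskian is $1$). A partition $\lambda=(\lambda_1,\dots,\lambda_{r_1})$ is a weakly decreasing (possibly empty) finite sequence of positive integers, $r_1$ is its length and $|\lambda|=\sum_j\lambda_j$. To partitions $\lambda$ of length $r_1$ and $\mu$ of length $r_2$ associate $n_j=\lambda_j+r_1-j$ ($1\le j\le r_1$),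 $m_j=\mu_j+r_2-j$ ($1\le j\le r_2$), $r=r_1+r_2$, and the functions $f_j(x)=L^{(\alpha)}_{n_j}(x)$ for $j=1,\dots,r_1$ and $f_{r_1+j}(x)=e^xL^{(\alpha)}_{m_j}(-x)$ for $j=1,\dots,r_2$. The degree sequence is $$\mathbb{N}_{\lambda,\mu}=\{n\in\{0,1,2,\dots\} : n\ge|\lambda|+|\mu|-r_1 \text{ and } n-|\lambda|-|\mu|\ne\lambda_j-j \text{ for } j=1,\dots,r_1\}.$$ For $n\in\mathbb{N}_{\lambda,\mu}$ the exceptional Laguerre polynomial is $$L^{(\alpha)}_{\lambda,\mu,n}(x)=e^{-r_2x}\,\mathrm{Wr}\left[f_1,\dots,f_r,L^{(\alpha)}_s\right](x),\qquad s=n-|\lambda|-|\mu|+r_1,$$ which is a polynomial of degree $n$. *)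

theory Defs
  imports "HOL-Analysis.Analysis" "Jordan_Normal_Form.Determinant"
begin

definition laguerre :: "real \<Rightarrow> nat \<Rightarrow> real poly" where
  "laguerre \<alpha> n =
    (\<Sum>k\<le>n. monom (((real n + \<alpha>) gchoose (n - k)) * (-1) ^ k / fact k) k)"

lemma poly_laguerre:
  "poly (laguerre \<alpha> n) x = (\<Sum>k\<le>n. ((real n + \<alpha>) gchoose (n - k)) * (- x) ^ k / fact k)"
  unfolding laguerre_def poly_sum poly_monom
  by (rule sum.cong) (auto simp: power_minus[of x])

lemma higher_deriv_exp_powr:
  fixes \<beta> x :: real
  assumes "x > 0"
  shows "(deriv ^^ k) (\<lambda>t. exp (- t) * t powr \<beta>) x =
    exp (- x) * (\<Sum>j\<le>k. real (k choose j) * (-1) ^ (k + j) * (fact j * (\<beta> gchoose j)) * x powr (\<beta> - real j))"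
  using assms
proof (induction k arbitrary: x)
  case 0
  then show ?case by simp
next
  case (Suc k)
  define a where "a = (\<lambda>k j. real (k choose j) * (-1) ^ (k + j) * (fact j * (\<beta> gchoose j)))"
  have rec0: "a (Suc k) 0 = - a k 0"
    by (simp add: a_def)
  have ff: "fact (Suc j) * (\<beta> gchoose Suc j) = (\<beta> - real j) * (fact j * (\<beta> gchoose j))" for j
    by (simp add: gbinomial_absorption' gbinomial_prod_rev prod.atLeast0_lessThan_Suc)
  have rec: "a (Suc k) (Suc j) = - a k (Suc j) + (\<beta> - real j) * a k j" for j
    unfolding a_def ff by (simp add: algebra_simps)
  have top: "a k (Suc k) = 0" by (simp add: a_def)
  let ?S = "\<lambda>t. exp (- t) * (\<Sum>j\<le>k. a k j * t powr (\<beta> - real j))"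
  have D: "(?S has_real_derivative
      - exp (- x) * (\<Sum>j\<le>k. a k j * x powr (\<beta> - real j))
      + exp (- x) * (\<Sum>j\<le>k. a k j * ((\<beta> - real j) * x powr (\<beta> - real j - 1)))) (at x)"
    using Suc.prems by (auto intro!: derivative_eq_intros sum.cong)
  have ev: "\<forall>\<^sub>F t in nhds x. (deriv ^^ k) (\<lambda>t. exp (- t) * t powr \<beta>) t = ?S t"
    using eventually_nhds_in_open[of "{0<..}" x] Suc.prems
    by (auto elim!: eventually_mono simp: Suc.IH a_def)
  have "(deriv ^^ Suc k) (\<lambda>t. exp (- t) * t powr \<beta>) x = deriv ?S x"
    using deriv_cong_ev[OF ev refl] by simp
  also have "\<dots> = exp (- x) * ((\<Sum>j\<le>k. a k j * (\<beta> - real j) * x powr (\<beta> - real (Suc j)))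
        - (\<Sum>j\<le>k. a k j * x powr (\<beta> - real j)))"
    unfolding DERIV_imp_deriv[OF D] by (simp add: algebra_simps)
  also have "(\<Sum>j\<le>k. a k j * x powr (\<beta> - real j)) = (\<Sum>j\<le>Suc k. a k j * x powr (\<beta> - real j))"
    by (simp add: top)
  also have "\<dots> = a k 0 * x powr \<beta> + (\<Sum>j\<le>k. a k (Suc j) * x powr (\<beta> - real (Suc j)))"
    by (subst sum.atMost_Suc_shift) simp
  also have "(\<Sum>j\<le>k. a k j * (\<beta> - real j) * x powr (\<beta> - real (Suc j))) - \<dots> =
      a (Suc k) 0 * x powr \<beta> + (\<Sum>j\<le>k. a (Suc k) (Suc j) * x powr (\<beta> - real (Suc j)))"
    unfolding rec rec0 by (simp add: algebra_simps sum.distrib sum_subtractf)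
  also have "\<dots> = (\<Sum>j\<le>Suc k. a (Suc k) j * x powr (\<beta> - real j))"
    by (subst sum.atMost_Suc_shift) simp
  finally show ?case by (simp only: a_def)
qed

text \<open>The explicit polynomial agrees with Rodrigues' formula.\<close>

lemma laguerre_rodrigues:
  assumes "x > 0"
  shows "poly (laguerre \<alpha> n) x =
    exp x * x powr (- \<alpha>) / fact n * (deriv ^^ n) (\<lambda>t. exp (- t) * t powr (real n + \<alpha>)) x"
proof -
  have "exp x * x powr (- \<alpha>) / fact n * (deriv ^^ n) (\<lambda>t. exp (- t) * t powr (real n + \<alpha>)) x
     = (\<Sum>j\<le>n. x powr (- \<alpha>) / fact n * (real (n choose j) * (-1) ^ (n + j) *
          (fact j * ((real n + \<alpha>) gchoose j)) * x powr (real n + \<alpha> - real j)))"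
    unfolding higher_deriv_exp_powr[OF assms]
    by (simp add: exp_minus field_simps sum_distrib_left)
  also have "\<dots> = (\<Sum>j\<le>n. ((real n + \<alpha>) gchoose j) * (- x) ^ (n - j) / fact (n - j))"
  proof (rule sum.cong[OF refl])
    fix j assume "j \<in> {..n}"
    hence j: "j \<le> n" by simp
    have "x powr (- \<alpha>) * x powr (real n + \<alpha> - real j) = x ^ (n - j)"
      using assms j by (simp add: powr_add[symmetric] powr_realpow[symmetric] of_nat_diff)
    moreover have "(-1::real) ^ (n + j) = (-1) ^ (n - j)"
      using j by (simp add: minus_one_power_iff)
    moreover have "real (n choose j) * fact j / fact n = 1 / fact (n - j)"
      using j by (simp add: binomial_fact)
    moreover have "(- x) ^ (n - j) = (-1) ^ (n - j) * x ^ (n - j)"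
      by (rule power_minus)
    ultimately show "x powr (- \<alpha>) / fact n * (real (n choose j) * (-1) ^ (n + j) *
          (fact j * ((real n + \<alpha>) gchoose j)) * x powr (real n + \<alpha> - real j))
        = ((real n + \<alpha>) gchoose j) * (- x) ^ (n - j) / fact (n - j)"
      using j by (simp add: field_simps)
  qed
  also have "\<dots> = poly (laguerre \<alpha> n) x"
    unfolding poly_laguerre
    by (rule sum.reindex_bij_witness[of _ "\<lambda>k. n - k" "\<lambda>k. n - k"]) auto
  finally show ?thesis ..
qed

definition wronskian :: "(real \<Rightarrow> real) list \<Rightarrow> real \<Rightarrow> real" where
  "wronskian fs x =
    Determinant.det (Matrix.mat (length fs) (length fs) (\<lambda>(i, j). (deriv ^^ j) (fs ! i) x))"

definition is_partition :: "nat list \<Rightarrow> bool" where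
  "is_partition ps \<longleftrightarrow> sorted_wrt (\<ge>) ps \<and> (\<forall>p \<in> set ps. p > 0)"

text \<open>
  Lists are indexed from 0, so the part with (1-based) index \<open>j\<close> is \<open>ps ! (j - 1)\<close>;
  the subtraction below never truncates for \<open>1 \<le> j \<le> length ps\<close>.
\<close>

definition shifted_part :: "nat list \<Rightarrow> nat \<Rightarrow> nat" where
  "shifted_part ps j = ps ! (j - 1) + length ps - j"

definition seed_functions :: "real \<Rightarrow> nat list \<Rightarrow> nat list \<Rightarrow> (real \<Rightarrow> real) list" where
  "seed_functions \<alpha> lam mu =
    map (\<lambda>j x. poly (laguerre \<alpha> (shifted_part lam j)) x) [1..<length lam + 1] @
    map (\<lambda>j x. exp x * poly (laguerre \<alpha> (shifted_part mu j)) (- x)) [1..<length mu + 1]"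

definition degree_sequence :: "nat list \<Rightarrow> nat list \<Rightarrow> nat set" where
  "degree_sequence lam mu =
    {n. int n \<ge> int (sum_list lam) + int (sum_list mu) - int (length lam) \<and>
        (\<forall>j \<in> {1..length lam}.
           int n - int (sum_list lam) - int (sum_list mu) \<noteq> int (lam ! (j - 1)) - int j)}"

text \<open>
  The subtraction in the index of the last Laguerre polynomial does not truncate for
  \<open>n \<in> degree_sequence lam mu\<close>.
\<close>

definition exc_laguerre_fun :: "real \<Rightarrow> nat list \<Rightarrow> nat list \<Rightarrow> nat \<Rightarrow> real \<Rightarrow> real" where
  "exc_laguerre_fun \<alpha> lam mu n x =
    exp (- real (length mu) * x) *
    wronskian (seed_functions \<alpha> lam mu @
      [poly (laguerre \<alpha> (n + length lam - (sum_list lam + sum_list mu)))]) x"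

text \<open>
  The exceptional Laguerre polynomial is the polynomial inducing this function; it exists and is
  unique by \<open>poly_exc_laguerre\<close> below.
\<close>

definition exc_laguerre :: "real \<Rightarrow> nat list \<Rightarrow> nat list \<Rightarrow> nat \<Rightarrow> real poly" where
  "exc_laguerre \<alpha> lam mu n = (THE p. \<forall>x. poly p x = exc_laguerre_fun \<alpha> lam mu n x)"

definition positive_zeros :: "real poly \<Rightarrow> real set" where
  "positive_zeros p = {x. x > 0 \<and> poly p x = 0}"

definition num_positive_zeros :: "real poly \<Rightarrow> nat" where
  "num_positive_zeros p = (\<Sum>x \<in> positive_zeros p. order x p)"

definition num_simple_positive_zeros :: "real poly \<Rightarrow> nat" where
  "num_simple_positive_zeros p = card {x \<in> positive_zeros p. order x p = 1}"

lemma higher_deriv_exp_poly: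
  fixes c :: real
  shows "(deriv ^^ j) (\<lambda>x. exp (c * x) * poly p x) =
    (\<lambda>x. exp (c * x) * poly (((\<lambda>q. [:c:] * q + pderiv q) ^^ j) p) x)"
proof (induction j)
  case (Suc j)
  define q where "q = ((\<lambda>q. [:c:] * q + pderiv q) ^^ j) p"
  have "deriv (\<lambda>x. exp (c * x) * poly q x) x = exp (c * x) * poly ([:c:] * q + pderiv q) x" for x
    by (rule DERIV_imp_deriv) (auto intro!: derivative_eq_intros simp: algebra_simps)
  with Suc show ?case by (simp add: q_def)
qed simp

lemma wronskian_exp_poly:
  "\<exists>p. \<forall>x. wronskian (map (\<lambda>(c, p) x. exp (c * x) * poly p x) qs) x =
    exp (sum_list (map fst qs) * x) * poly p x"
proof -
  define n where "n = length qs"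
  define P where "P = (\<lambda>i j. ((\<lambda>q. [:fst (qs ! i):] * q + pderiv q) ^^ j) (snd (qs ! i)))"
  define p where "p = Determinant.det (Matrix.mat n n (\<lambda>(i, j). P i j))"
  have exps: "exp (sum_list (map fst qs) * x) = (\<Prod>i = 0..<n. exp (fst (qs ! i) * x))" for x
    by (simp add: n_def sum_list_sum_nth sum_distrib_right exp_sum)
  have "wronskian (map (\<lambda>(c, p) x. exp (c * x) * poly p x) qs) x =
      exp (sum_list (map fst qs) * x) * poly p x" for x
  proof -
    let ?S = "{\<pi>. \<pi> permutes {0..<n}}"
    have less: "\<pi> i < n" if "\<pi> permutes {0..<n}" "i < n" for \<pi> i
      using that permutes_in_image[of \<pi> "{0..<n}" i] by simp
    have "wronskian (map (\<lambda>(c, p) x. exp (c * x) * poly p x) qs) x =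
        (\<Sum>\<pi> \<in> ?S. signof \<pi> * (\<Prod>i = 0..<n. exp (fst (qs ! i) * x) * poly (P i (\<pi> i)) x))"
      unfolding wronskian_def Determinant.det_def n_def
      by (auto intro!: sum.cong prod.cong
          simp: P_def case_prod_beta higher_deriv_exp_poly less[unfolded n_def])
    also have "\<dots> = exp (sum_list (map fst qs) * x) *
        (\<Sum>\<pi> \<in> ?S. signof \<pi> * (\<Prod>i = 0..<n. poly (P i (\<pi> i)) x))"
      unfolding exps prod.distrib sum_distrib_left by (simp only: mult_ac)
    also have "(\<Sum>\<pi> \<in> ?S. signof \<pi> * (\<Prod>i = 0..<n. poly (P i (\<pi> i)) x)) = poly p x"
      unfolding p_def Determinant.det_def
      by (auto intro!: sum.cong prod.cong simp: poly_sum poly_prod less sign_def)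
    finally show ?thesis .
  qed
  thus ?thesis by blast
qed

lemma poly_exc_laguerre:
  "poly (exc_laguerre \<alpha> lam mu n) x = exc_laguerre_fun \<alpha> lam mu n x"
proof -
  define s where "s = n + length lam - (sum_list lam + sum_list mu)"
  define qs where "qs =
     map (\<lambda>j. (0::real, laguerre \<alpha> (shifted_part lam j))) [1..<length lam + 1] @
     map (\<lambda>j. (1, pcompose (laguerre \<alpha> (shifted_part mu j)) [:0, -1:])) [1..<length mu + 1] @
     [(0, laguerre \<alpha> s)]"
  have 1: "seed_functions \<alpha> lam mu @ [poly (laguerre \<alpha> s)] =
      map (\<lambda>(c, p) x. exp (c * x) * poly p x) qs"
    by (simp add: seed_functions_def qs_def poly_pcompose o_def)
  have 2: "sum_list (map fst qs) = real (length mu)"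
    by (cases "length mu") (simp_all add: qs_def o_def sum_list_triv)
  obtain p where p: "\<And>x. wronskian (map (\<lambda>(c, p) x. exp (c * x) * poly p x) qs) x =
      exp (sum_list (map fst qs) * x) * poly p x"
    using wronskian_exp_poly by blast
  have p: "\<forall>x. poly p x = exc_laguerre_fun \<alpha> lam mu n x"
    unfolding exc_laguerre_fun_def s_def[symmetric] 1 p 2
    by (simp flip: exp_add mult.assoc)
  have "\<forall>x. poly (exc_laguerre \<alpha> lam mu n) x = exc_laguerre_fun \<alpha> lam mu n x"
    unfolding exc_laguerre_def
    by (rule theI[of _ p]) (use p in \<open>auto simp: poly_eq_poly_eq_iff[symmetric]\<close>)
  thus ?thesis by blast
qed

end

theory Submission
  imports Defs
begin

text \<open>
  The exceptional Laguerre polynomial \<open>P\<close> is a determinant whose rows are the derivatives of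
  functions \<open>exp (c x) p(x)\<close>, \<open>c \<in> {0, 1}\<close>, with the exponential factors removed. Expanding
  \<open>(c + D)^j = \<Sum>l. (j choose l) c^(j - l) D^l\<close> row by row writes \<open>P\<close> as a combination of products
  of derivatives of the polynomial parts; a term survives only if the orders of differentiation are
  distinct among rows with equal \<open>c\<close>. Hence the factor accompanying a derivative of \<open>L_s\<close> has degree
  at most \<open>|\<lambda>| + |\<mu>|\<close>, and \<open>P\<close> is orthogonal to all polynomials of degree less than
  \<open>s - r - |\<lambda>| - |\<mu>| = n - 2(|\<lambda>| + |\<mu>|) - r\<^sub>2\<close> for the weight \<open>x powr (\<alpha> + r) * exp (-x)\<close> on \<open>(0, \<infinity>)\<close>.
  So \<open>P\<close> changes sign at least that often. As the degree of \<open>P\<close> exceeds this number by a bounded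
  amount, only boundedly many sign changes can occur at zeros of order 3 or more.
\<close>

hide_const (open) Module.smult

subsection \<open>Integration against the gamma weight\<close>

lemma has_integral_gamma_weight_monom:
  fixes \<beta> :: real
  assumes "\<beta> > -1"
  shows "((\<lambda>x. x powr \<beta> * exp (-x) * poly (monom 1 k) x) has_integral Gamma (\<beta> + 1 + real k)) {0..}"
proof (rule has_integral_eq)
  show "((\<lambda>t. t powr (\<beta> + 1 + real k - 1) / exp t) has_integral Gamma (\<beta> + 1 + real k)) {0..}"
    using assms by (intro Gamma_integral_real) auto
  fix x :: real assume "x \<in> {0..}"
  then show "x powr (\<beta> + 1 + real k - 1) / exp x = x powr \<beta> * exp (-x) * poly (monom 1 k) x"
    \<comment> \<open>Since \<open>0 powr y\<close> is 0 for every \<open>y\<close>, both sides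
      vanish at 0 even when \<beta> is negative.\<close>
    by (cases "x = 0") (auto simp: powr_add powr_realpow exp_minus field_simps poly_monom)
qed

lemma gamma_weight_integrable:
  fixes \<beta> :: real
  assumes "\<beta> > -1"
  shows "(\<lambda>x. x powr \<beta> * exp (-x) * poly p x) integrable_on {0..}"
proof -
  have "(\<lambda>x. \<Sum>k\<le>degree p. coeff p k * (x powr \<beta> * exp (-x) * poly (monom 1 k) x)) integrable_on {0..}"
    using has_integral_gamma_weight_monom[OF assms]
    by (intro integrable_sum integrable_on_mult_right) (auto simp: integrable_on_def)
  moreover have "(\<Sum>k\<le>degree p. coeff p k * (x powr \<beta> * exp (-x) * poly (monom 1 k) x))
      = x powr \<beta> * exp (-x) * poly p x" for x
    by (simp add: poly_altdef[of p] sum_distrib_left poly_monom mult_ac)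
  ultimately show ?thesis by simp
qed

definition gamma_functional :: "real \<Rightarrow> real poly \<Rightarrow> real" where
  "gamma_functional \<beta> p = integral {0..} (\<lambda>x. x powr \<beta> * exp (-x) * poly p x)"

lemma gamma_functional_monom:
  "\<beta> > -1 \<Longrightarrow> gamma_functional \<beta> (monom 1 k) = Gamma (\<beta> + 1 + real k)"
  unfolding gamma_functional_def
  by (rule integral_unique) (rule has_integral_gamma_weight_monom)

lemma gamma_functional_smult:
  "gamma_functional \<beta> (smult c p) = c * gamma_functional \<beta> p"
proof -
  have "(\<lambda>x. x powr \<beta> * exp (-x) * poly (smult c p) x) = (\<lambda>x. c * (x powr \<beta> * exp (-x) * poly p x))"
    by (simp add: mult_ac)
  then show ?thesis
    by (simp add: gamma_functional_def del: poly_smult)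
qed

lemma gamma_functional_add:
  assumes "\<beta> > -1"
  shows "gamma_functional \<beta> (p + q) = gamma_functional \<beta> p + gamma_functional \<beta> q"
  unfolding gamma_functional_def
  by (simp add: ring_distribs integral_add gamma_weight_integrable[OF assms])

lemma gamma_functional_sum:
  assumes "\<beta> > -1"
  shows "gamma_functional \<beta> (sum f A) = (\<Sum>x\<in>A. gamma_functional \<beta> (f x))"
  using gamma_functional_smult[of \<beta> 0 0]
  by (induction A rule: infinite_finite_induct) (simp_all add: gamma_functional_add[OF assms])

text \<open>The integrand is nonnegative, and near a point \<open>y > 0\<close> that is not one of
  the finitely many roots of \<open>p\<close> it already has positive integral.\<close>

lemma gamma_functional_pos:
  assumes "\<beta> > -1" "p \<noteq> 0" and nonneg: "\<And>x. x > 0 \<Longrightarrow> poly p x \<ge> 0"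
  shows "gamma_functional \<beta> p > 0"
proof -
  let ?f = "\<lambda>x. x powr \<beta> * exp (-x) * poly p x"
  have int: "?f integrable_on {0..}"
    by (rule gamma_weight_integrable[OF assms(1)])
  have f_nonneg: "?f x \<ge> 0" if "x \<in> {0..}" for x
    using nonneg[of x] that by (cases "x = 0") auto
  have "\<not> {0<..} \<subseteq> {x. poly p x = 0}"
    using poly_roots_finite[OF \<open>p \<noteq> 0\<close>] infinite_Ioi finite_subset by blast
  then obtain y where y: "y > 0" "poly p y \<noteq> 0" by auto
  \<comment> \<open>This interval stays away from 0, where \<open>x powr \<beta>\<close> need not be
    continuous.\<close>
  let ?I = "cbox (y / 2) (2 * y)"
  have sub: "?I \<subseteq> {0..}" using y by auto
  have cont: "continuous_on ?I ?f"
    using y by (auto intro!: continuous_intros)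
  have intI: "?f integrable_on ?I" by (rule integrable_continuous[OF cont])
  have le: "integral ?I ?f \<le> gamma_functional \<beta> p"
    unfolding gamma_functional_def
    by (rule integral_subset_le[OF sub intI int]) (use f_nonneg in blast)
  have "integral ?I ?f \<noteq> 0"
  proof
    assume "integral ?I ?f = 0"
    then have "(?f has_integral 0) ?I"
      using intI by (simp add: has_integral_integrable_integral)
    moreover have "?f x \<ge> 0" if "x \<in> box (y / 2) (2 * y)" for x
      using f_nonneg[of x] that y by auto
    moreover have "box (y / 2) (2 * y) \<noteq> {}" "y \<in> ?I" using y by auto
    ultimately have "?f y = 0"
      using has_integral_0_cbox_imp_0[OF cont] by blast
    then show False using y by auto
  qed
  moreover have "integral ?I ?f \<ge> 0"
    using f_nonneg sub by (intro integral_nonneg[OF intI]) blast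
  ultimately show ?thesis using le by linarith
qed

section \<open>Derivatives of Laguerre polynomials and orthogonality\<close>

lemma coeff_laguerre:
  "coeff (laguerre \<alpha> n) i = (if i \<le> n then ((real n + \<alpha>) gchoose (n - i)) * (-1) ^ i / fact i else 0)"
  by (simp add: laguerre_def coeff_sum)

lemma degree_laguerre [simp]: "degree (laguerre \<alpha> n) = n"
  by (intro antisym degree_le le_degree) (auto simp: coeff_laguerre)

lemma laguerre_nonzero [simp]: "laguerre \<alpha> n \<noteq> 0"
  using coeff_laguerre[of \<alpha> n n] by auto

text \<open>The right-hand side is (-1)^k times the Laguerre polynomial of degree n - k with
  parameter \<alpha> + k, written in monomials for termwise integration.\<close>

lemma higher_pderiv_laguerre:
  assumes "k \<le> n"
  shows "(pderiv ^^ k) (laguerre \<alpha> n) =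
    (\<Sum>j\<le>n - k. smult (((real n + \<alpha>) gchoose (n - k - j)) * (-1) ^ (j + k) / fact j) (monom 1 j))"
proof (rule poly_eqI)
  fix j
  have "pochhammer (1 + real j) k * fact j = fact (j + k)"
    using pochhammer_product'[of "1::real" j k] by (simp add: pochhammer_fact mult_ac)
  then have *: "pochhammer (1 + real j) k / fact (j + k) = 1 / fact j"
    by (simp add: field_simps)
  have "coeff ((pderiv ^^ k) (laguerre \<alpha> n)) j =
     (if j \<le> n - k then ((real n + \<alpha>) gchoose (n - k - j)) * (-1) ^ (j + k) *
         (pochhammer (1 + real j) k / fact (j + k)) else 0)"
    using assms by (auto simp: coeff_higher_pderiv coeff_laguerre add.commute)
  also have "\<dots> = coeff (\<Sum>j\<le>n - k.
      smult (((real n + \<alpha>) gchoose (n - k - j)) * (-1) ^ (j + k) / fact j) (monom 1 j)) j"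
    unfolding * by (auto simp: coeff_sum if_distrib cong: if_cong)
  finally show "coeff ((pderiv ^^ k) (laguerre \<alpha> n)) j = \<dots>" .
qed

text \<open>
  This is orthogonality of the Laguerre polynomial with parameter \<open>\<alpha> + k\<close> and degree \<open>s - k\<close> to
  \<open>x^(N + r - k)\<close>. Only the total exponent \<open>\<alpha> + r\<close> has to exceed \<open>-1\<close>: after integrating termwise,
  the claim is the Vandermonde convolution, which holds for every real \<open>\<alpha>\<close>.
\<close>

lemma gamma_functional_monom_pderiv_laguerre:
  assumes \<beta>: "\<alpha> + real r > -1" and "k \<le> r" "N + r < s"
  shows "gamma_functional (\<alpha> + real r) (monom 1 N * (pderiv ^^ k) (laguerre \<alpha> s)) = 0"
proof -
  \<comment> \<open>The moment of x^(N + j) for this weight is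
    \<open>Gamma (z + real j)\<close>.\<close>
  define z where "z = \<alpha> + real r + 1 + real N"
  have "z > 0" using \<beta> by (simp add: z_def)
  then have "z \<notin> \<int>\<^sub>\<le>\<^sub>0" by (auto elim!: nonpos_Ints_cases)
  then have Gamma: "Gamma (z + real j) = pochhammer z j * Gamma z" for j
    using pochhammer_Gamma[of z j] Gamma_eq_zero_iff[of z] by (simp add: field_simps)
  define m where "m = s - k"
  have "gamma_functional (\<alpha> + real r) (monom 1 N * (pderiv ^^ k) (laguerre \<alpha> s)) =
      (\<Sum>j\<le>m. (((real s + \<alpha>) gchoose (m - j)) * (-1) ^ (j + k) / fact j) * Gamma (z + real j))"
    using assms
    by (simp add: higher_pderiv_laguerre sum_distrib_left gamma_functional_sum gamma_functional_smult
        mult_monom gamma_functional_monom m_def z_def add_ac)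
  \<comment> \<open>The factor (-1)^j \<open>pochhammer z j\<close> / j! is the generalized binomial
    coefficient of -z over j, which turns the sum into a convolution.\<close>
  also have "\<dots> = (-1) ^ k * Gamma z * (\<Sum>j\<le>m. ((-z) gchoose j) * ((real s + \<alpha>) gchoose (m - j)))"
    by (simp add: Gamma gbinomial_pochhammer[of "-z"] sum_distrib_left power_add mult_ac)
  also have "(\<Sum>j\<le>m. ((-z) gchoose j) * ((real s + \<alpha>) gchoose (m - j))) = ((-z + (real s + \<alpha>)) gchoose m)"
    using gbinomial_Vandermonde[of "-z" "real s + \<alpha>" m] by (simp add: atLeast0AtMost)
  also have "-z + (real s + \<alpha>) = real (s - r - 1 - N)"
    using assms by (simp add: z_def of_nat_diff)
  \<comment> \<open>The upper entry is a natural number below m = s - k, because k \<le> r.\<close>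
  also have "(real (s - r - 1 - N) gchoose m) = 0"
    using assms
    by (simp add: m_def binomial_gbinomial[symmetric] binomial_eq_0 del: of_nat_diff of_nat_diff_if)
  finally show ?thesis by simp
qed

lemma gamma_functional_mult_pderiv_laguerre:
  assumes \<beta>: "\<alpha> + real r > -1" and "k \<le> r" "degree q + r < s"
  shows "gamma_functional (\<alpha> + real r) (q * (pderiv ^^ k) (laguerre \<alpha> s)) = 0"
proof -
  have "q * (pderiv ^^ k) (laguerre \<alpha> s) =
      (\<Sum>i\<le>degree q. smult (coeff q i) (monom 1 i * (pderiv ^^ k) (laguerre \<alpha> s)))"
    by (subst poly_as_sum_of_monoms[of q, symmetric])
      (simp add: sum_distrib_right smult_monom flip: mult_smult_left)
  then show ?thesis
    using assms
    by (simp add: gamma_functional_sum gamma_functional_smult gamma_functional_monom_pderiv_laguerre)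
qed

section \<open>Sign changes forced by orthogonality\<close>

lemma order_linear_factor: "order x [:-z, 1:] = (if x = z then 1 else 0)"
  for x z :: real
  using order_power_n_n[of z 1] by (auto intro: order_0I)

text \<open>Dividing out the square of a linear factor at a positive root preserves sign and parity
  and lowers the degree; without positive roots the intermediate value theorem applies.\<close>

lemma poly_even_orders_const_sign:
  fixes p :: "real poly"
  assumes "p \<noteq> 0" and "\<And>x. x > 0 \<Longrightarrow> even (order x p)"
  shows "(\<forall>x>0. poly p x \<ge> 0) \<or> (\<forall>x>0. poly p x \<le> 0)"
  using assms
proof (induction "degree p" arbitrary: p rule: less_induct)
  case less
  show ?case
  proof (cases "\<exists>z>0. poly p z = 0")
    case True
    then obtain z where z: "z > 0" "poly p z = 0" by blast
    with less.prems have "order z p \<ge> 2"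
      using order_root[of p z] less.prems(2)[of z] by (auto intro: dvd_imp_le)
    then have "[:-z, 1:] ^ 2 dvd p"
      using order_1[of z p] by (meson dvd_trans le_imp_power_dvd)
    then obtain q where q: "p = [:-z, 1:] ^ 2 * q" by (auto elim: dvdE)
    with less.prems have "q \<noteq> 0" by auto
    have "degree q < degree p"
      using \<open>q \<noteq> 0\<close> unfolding q by (simp add: degree_mult_eq degree_linear_power)
    moreover have "even (order x q)" if "x > 0" for x
      using less.prems(2)[OF that] less.prems(1) \<open>q \<noteq> 0\<close> unfolding q
      by (simp add: order_mult order_linear_factor power2_eq_square del: mult_pCons_left mult_pCons_right)
    ultimately have "(\<forall>x>0. poly q x \<ge> 0) \<or> (\<forall>x>0. poly q x \<le> 0)"
      using less.hyps \<open>q \<noteq> 0\<close> by blast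
    then show ?thesis
      unfolding q by (auto simp: mult_nonneg_nonpos)
  next
    case False
    have False if "x > 0" "y > 0" "poly p x < 0" "poly p y > 0" for x y
      using that poly_IVT[of x y p] poly_IVT[of y x p] False
      by (cases x y rule: linorder_cases) (force simp: mult_less_0_iff)+
    then show ?thesis by (meson not_le)
  qed
qed

lemma card_odd_order_roots:
  fixes P :: "real poly"
  assumes \<beta>: "\<beta> > -1" and "P \<noteq> 0"
    and orth: "\<And>p. degree p < M \<Longrightarrow> gamma_functional \<beta> (P * p) = 0"
  shows "M \<le> card {x. x > 0 \<and> odd (order x P)}"
proof (rule ccontr)
  define Z where "Z = {x. x > 0 \<and> odd (order x P)}"
  \<comment> \<open>Multiplying \<open>P\<close> by \<open>q\<close> makes every order on the
    positive axis even, so \<open>P * q\<close> has constant sign there and cannot integrate to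
    0.\<close>
  define q where "q = (\<Prod>z\<in>Z. [:-z, 1:])"
  assume "\<not> ?thesis"
  then have "card Z < M" by (simp add: Z_def)
  have "Z \<subseteq> {x. poly P x = 0}"
    using \<open>P \<noteq> 0\<close> by (auto simp: Z_def order_root elim: oddE)
  then have fin: "finite Z"
    using poly_roots_finite[OF \<open>P \<noteq> 0\<close>] finite_subset by blast
  have "degree q = card Z"
    unfolding q_def by (subst degree_prod_eq_sum_degree) auto
  then have zero: "gamma_functional \<beta> (P * q) = 0"
    using \<open>card Z < M\<close> orth by simp
  have "q \<noteq> 0" using fin by (auto simp: q_def)
  then have nz: "P * q \<noteq> 0" using \<open>P \<noteq> 0\<close> by simp
  have "order x q = (if x \<in> Z then 1 else 0)" for x
    using fin unfolding q_def
    by (induction Z rule: finite_induct)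
      (auto simp: order_mult order_linear_factor simp del: mult_pCons_left)
  then have "even (order x (P * q))" if "x > 0" for x
    using that nz by (auto simp: order_mult Z_def)
  then consider "\<forall>x>0. poly (P * q) x \<ge> 0" | "\<forall>x>0. poly (smult (-1) (P * q)) x \<ge> 0"
    using poly_even_orders_const_sign[OF nz] by fastforce
  then show False
  proof cases
    case 1
    then show False using gamma_functional_pos[OF \<beta> nz] zero by auto
  next
    case 2
    then have "gamma_functional \<beta> (smult (-1) (P * q)) > 0"
      using nz by (intro gamma_functional_pos[OF \<beta>]) auto
    then show False using zero unfolding gamma_functional_smult by simp
  qed
qed

subsection \<open>Wronskians of exponential polynomials\<close>

text \<open>This is (c + D)^j, the j-th derivative conjugated by exp (c x): the polynomial factor
  left after differentiating exp (c x) q(x).\<close>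

definition exp_deriv :: "real \<Rightarrow> nat \<Rightarrow> real poly \<Rightarrow> real poly" where
  "exp_deriv c j = (\<lambda>q. [:c:] * q + pderiv q) ^^ j"

lemma smult_sum_right: "smult c (sum f A) = (\<Sum>x\<in>A. smult c (f x))"
  by (induction A rule: infinite_finite_induct) (simp_all add: smult_add_right)

lemma exp_deriv_expand:
  "exp_deriv c j p = (\<Sum>l\<le>j. smult (real (j choose l) * c ^ (j - l)) ((pderiv ^^ l) p))"
proof (induction j)
  case 0
  then show ?case by (simp add: exp_deriv_def)
next
  case (Suc j)
  let ?D = "\<lambda>l. (pderiv ^^ l) p"
  let ?a = "\<lambda>j l. real (j choose l) * c ^ (j - l)"
  have "exp_deriv c (Suc j) p = smult c (exp_deriv c j p) + pderiv (exp_deriv c j p)"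
    by (simp add: exp_deriv_def)
  also have "smult c (exp_deriv c j p) = (\<Sum>l\<le>j. smult (c * ?a j l) (?D l))"
    unfolding Suc by (simp add: smult_sum_right)
  also have "\<dots> = (\<Sum>l\<le>Suc j. smult (c * ?a j l) (?D l))"
    by simp
  also have "\<dots> = smult (c * c ^ j) p + (\<Sum>l\<le>j. smult (c * ?a j (Suc l)) (?D (Suc l)))"
    by (subst sum.atMost_Suc_shift) simp
  also have "pderiv (exp_deriv c j p) = (\<Sum>l\<le>j. smult (?a j l) (?D (Suc l)))"
    unfolding Suc by (simp add: higher_pderiv_sum[of 1, simplified] pderiv_smult)
  also have "smult (c * c ^ j) p + (\<Sum>l\<le>j. smult (c * ?a j (Suc l)) (?D (Suc l)))
        + (\<Sum>l\<le>j. smult (?a j l) (?D (Suc l)))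
      = smult (c * c ^ j) p + (\<Sum>l\<le>j. smult (c * ?a j (Suc l) + ?a j l) (?D (Suc l)))"
    by (simp add: sum.distrib smult_add_left add.assoc)
  also have "(\<Sum>l\<le>j. smult (c * ?a j (Suc l) + ?a j l) (?D (Suc l)))
      = (\<Sum>l\<le>j. smult (?a (Suc j) (Suc l)) (?D (Suc l)))"
  proof (rule sum.cong[OF refl])
    fix l assume "l \<in> {..j}"
    \<comment> \<open>For l = j the truncated exponent \<open>j - Suc l\<close> would give the wrong
      power of \<open>c\<close>, but there the binomial coefficient is 0.\<close>
    then have "c * ?a j (Suc l) = real (j choose Suc l) * c ^ (j - l)"
      by (cases "l = j") (auto simp: Suc_diff_Suc[symmetric])
    then have "c * ?a j (Suc l) + ?a j l = ?a (Suc j) (Suc l)"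
      by (simp only: binomial_Suc_Suc diff_Suc_Suc of_nat_add ring_distribs add.commute)
    then show "smult (c * ?a j (Suc l) + ?a j l) (?D (Suc l)) = smult (?a (Suc j) (Suc l)) (?D (Suc l))"
      by (simp only:)
  qed
  also have "smult (c * c ^ j) p + \<dots> = (\<Sum>l\<le>Suc j. smult (?a (Suc j) l) (?D l))"
    by (subst sum.atMost_Suc_shift) simp
  finally show ?case .
qed

text \<open>A summation range independent of \<open>j\<close> allows sums over columns and over
  orders of differentiation to be interchanged.\<close>

lemma exp_deriv_expand_less:
  assumes "j < N"
  shows "exp_deriv c j p = (\<Sum>l<N. smult (real (j choose l) * c ^ (j - l)) ((pderiv ^^ l) p))"
  unfolding exp_deriv_expand using assms
  by (intro sum.mono_neutral_left) (auto simp: binomial_eq_0)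



section \<open>Nonvanishing of the determinant\<close>

lemma coeff_mult_degree_le:
  assumes "degree p \<le> m" "degree q \<le> n"
  shows "coeff (p * q) (m + n) = coeff p m * coeff q n"
proof (cases "degree p = m \<and> degree q = n")
  case True
  then show ?thesis using coeff_mult_degree_sum[of p q] by auto
next
  case False
  then have "degree p < m \<or> degree q < n" using assms by auto
  moreover from this have "degree (p * q) < m + n"
    using degree_mult_le[of p q] assms by linarith
  ultimately show ?thesis by (auto simp: coeff_eq_0)
qed

text \<open>Expand y^j = ((y - c) + c)^j. The inner sum is the l-th Taylor coefficient of \<sigma>
  at c, in the form in which leading coefficients of a conjugated operator arise.\<close>

lemma taylor_poly:
  fixes \<sigma> :: "real poly"
  assumes "degree \<sigma> < N"
  shows "\<sigma> = (\<Sum>l<N. smult (\<Sum>j<N. coeff \<sigma> j * (real (j choose l) * c ^ (j - l))) ([:-c, 1:] ^ l))"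
proof (rule poly_ext)
  fix y
  have "poly \<sigma> y = (\<Sum>j\<le>degree \<sigma>. coeff \<sigma> j * y ^ j)"
    by (rule poly_altdef)
  also have "\<dots> = (\<Sum>j<N. coeff \<sigma> j * y ^ j)"
    using assms by (intro sum.mono_neutral_left) (auto simp: coeff_eq_0)
  also have "\<dots> = (\<Sum>j<N. \<Sum>l<N. coeff \<sigma> j * (real (j choose l) * c ^ (j - l)) * (y - c) ^ l)"
  proof (rule sum.cong[OF refl])
    fix j assume "j \<in> {..<N}"
    have "y ^ j = ((y - c) + c) ^ j" by simp
    also have "\<dots> = (\<Sum>l\<le>j. real (j choose l) * (y - c) ^ l * c ^ (j - l))"
      by (rule binomial_ring)
    also have "\<dots> = (\<Sum>l<N. real (j choose l) * (y - c) ^ l * c ^ (j - l))"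
      using \<open>j \<in> {..<N}\<close> by (intro sum.mono_neutral_left) (auto simp: binomial_eq_0)
    finally show "coeff \<sigma> j * y ^ j =
        (\<Sum>l<N. coeff \<sigma> j * (real (j choose l) * c ^ (j - l)) * (y - c) ^ l)"
      by (simp add: sum_distrib_left mult_ac)
  qed
  also have "\<dots> = (\<Sum>l<N. \<Sum>j<N. coeff \<sigma> j * (real (j choose l) * c ^ (j - l)) * (y - c) ^ l)"
    by (rule sum.swap)
  finally show "poly \<sigma> y = poly (\<Sum>l<N. smult (\<Sum>j<N. coeff \<sigma> j * (real (j choose l) * c ^ (j - l)))
      ([:-c, 1:] ^ l)) y"
    by (simp add: poly_sum sum_distrib_right)
qed

text \<open>Falling factorials are monic of degree l, so a nontrivial combination up to l = E is a
  nonzero polynomial with at most E roots.\<close>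

lemma card_falling_factorial_roots:
  fixes a :: "nat \<Rightarrow> real"
  assumes "k \<le> E" "a k \<noteq> 0"
    and root: "\<And>d. d \<in> S \<Longrightarrow> (\<Sum>l\<le>E. a l * (\<Prod>i<l. real d - real i)) = 0"
  shows "card S \<le> E"
proof -
  define \<phi> where "\<phi> = (\<lambda>l. \<Prod>i<l. [:- real i, 1:])"
  define q where "q = (\<Sum>l\<le>E. smult (a l) (\<phi> l))"
  have deg: "degree (\<phi> l) = l" for l
    unfolding \<phi>_def by (subst degree_prod_eq_sum_degree) auto
  have lead: "coeff (\<phi> l) l = 1" for l
    using lead_coeff_prod[of "\<lambda>i. [:- real i, 1:]" "{..<l}"] deg[of l] by (simp add: \<phi>_def)
  define m where "m = Max {l. l \<le> E \<and> a l \<noteq> 0}"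
  have "m \<in> {l. l \<le> E \<and> a l \<noteq> 0}"
    unfolding m_def using assms(1,2) by (intro Max_in) auto
  then have m: "m \<le> E" "a m \<noteq> 0" by auto
  have max: "l \<le> m" if "l \<le> E" "a l \<noteq> 0" for l
    unfolding m_def using that by (intro Max_ge) auto
  have "coeff q m = (\<Sum>l\<le>E. if l = m then a m else 0)"
    unfolding q_def coeff_sum
  proof (intro sum.cong refl)
    fix l assume "l \<in> {..E}"
    show "coeff (smult (a l) (\<phi> l)) m = (if l = m then a m else 0)"
      using max[of l] \<open>l \<in> {..E}\<close> lead[of m] deg[of l]
      by (cases "l < m") (auto simp: coeff_eq_0)
  qed
  with m have "q \<noteq> 0" by auto
  have "degree q \<le> E"
    unfolding q_def using deg by (intro degree_sum_le) (auto intro: order_trans[OF degree_smult_le])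
  have sub: "real ` S \<subseteq> {x. poly q x = 0}"
    using root by (auto simp: q_def \<phi>_def poly_sum poly_prod algebra_simps)
  have "card S = card (real ` S)"
    by (simp add: card_image)
  also have "\<dots> \<le> card {x. poly q x = 0}"
    using sub poly_roots_finite[OF \<open>q \<noteq> 0\<close>] by (rule card_mono[rotated])
  also have "\<dots> \<le> degree q"
    by (rule card_poly_roots_bound[OF \<open>q \<noteq> 0\<close>])
  finally show ?thesis using \<open>degree q \<le> E\<close> by simp
qed

text \<open>The operator x^l D^l is diagonal on monomials, with falling factorials as eigenvalues;
  for l > d the product contains the factor 0.\<close>

lemma coeff_monom_mult_higher_pderiv:
  fixes g :: "real poly"
  shows "coeff (monom 1 l * (pderiv ^^ l) g) d = (\<Prod>i<l. real d - real i) * coeff g d"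
proof (cases "l \<le> d")
  case True
  have "pochhammer (real d - real l + 1) l = (\<Prod>i<l. real d - real i)"
    using gbinomial_pochhammer'[of "real d" l] gbinomial_prod_rev[of "real d" l]
    by (simp add: atLeast0LessThan)
  with True show ?thesis
    by (simp add: coeff_monom_mult coeff_higher_pderiv of_nat_diff add_ac)
next
  case False
  then have "(\<Prod>i<l. real d - real i) = 0" by (intro prod_zero) auto
  with False show ?thesis by (simp add: coeff_monom_mult)
qed

text \<open>
  The operator \<open>\<Sum>j. b j D^j\<close>, conjugated by \<open>exp (c x)\<close>, equals \<open>\<Sum>l. B l D^l\<close> in the proof below.
  The top coefficient of its value at \<open>g\<close> is an indicial polynomial in \<open>degree g\<close>; a nonzero
  \<open>M\<close>-th coefficient of \<open>B E\<close> excludes contributions from \<open>l > E\<close>, so this polynomial has degree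
  at most \<open>E\<close>.
\<close>

lemma card_exp_deriv_solutions_le:
  assumes deg: "\<And>j. j < N \<Longrightarrow> degree (b j) \<le> M"
    and E: "E < N" "(\<Sum>j<N. coeff (b j) M * (real (j choose E) * c ^ (j - E))) \<noteq> 0"
    and sol: "\<And>g. g \<in> G \<Longrightarrow> g \<noteq> 0 \<and> (\<Sum>j<N. b j * exp_deriv c j g) = 0"
    and inj: "inj_on degree G"
  shows "card G \<le> E"
proof -
  define B where "B = (\<lambda>l. \<Sum>j<N. smult (real (j choose l) * c ^ (j - l)) (b j))"
  have degB: "degree (B l) \<le> M" for l
    unfolding B_def using deg by (intro degree_sum_le) (auto intro: order_trans[OF degree_smult_le])
  have coeffB: "coeff (B E) M \<noteq> 0"
    using E(2) by (simp add: B_def coeff_sum mult_ac)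
  then have BE: "B E \<noteq> 0" "degree (B E) = M"
    using degB[of E] le_degree[of "B E" M] by auto
  have expand: "(\<Sum>j<N. b j * exp_deriv c j g) = (\<Sum>l<N. B l * (pderiv ^^ l) g)" for g
  proof -
    have "(\<Sum>j<N. b j * exp_deriv c j g) =
        (\<Sum>j<N. \<Sum>l<N. smult (real (j choose l) * c ^ (j - l)) (b j) * (pderiv ^^ l) g)"
      by (intro sum.cong refl) (simp add: exp_deriv_expand_less sum_distrib_left)
    also have "\<dots> = (\<Sum>l<N. B l * (pderiv ^^ l) g)"
      unfolding B_def sum_distrib_right by (rule sum.swap)
    finally show ?thesis .
  qed
  define I where "I = {l. l < N \<and> B l \<noteq> 0}"
  \<comment> \<open>The term \<open>B l\<close> D^l raises degrees by at most
    \<open>degree (B l)\<close> - l. \<open>W\<close> is the maximum of this shift, with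
    \<open>N\<close> added to stay in the natural numbers.\<close>
  define W where "W = Max ((\<lambda>l. degree (B l) + (N - l)) ` I)"
  have I: "finite I" "E \<in> I" using BE E by (auto simp: I_def)
  have W_ge: "degree (B l) + (N - l) \<le> W" if "l \<in> I" for l
    unfolding W_def using that I by (intro Max_ge) auto
  have "W \<in> (\<lambda>l. degree (B l) + (N - l)) ` I"
    unfolding W_def using I by (intro Max_in) auto
  then obtain k where k: "k \<in> I" "W = degree (B k) + (N - k)" by auto
  define a where "a = (\<lambda>l. coeff (monom 1 (N - l) * B l) W)"
  have a_0: "a l = 0" if "l > E" "l < N" for l
  proof -
    have "W \<ge> M + (N - E)" using W_ge[OF I(2)] BE by simp
    then have "degree (B l) < W - (N - l)" using that degB[of l] by linarith
    then show ?thesis by (simp add: a_def coeff_monom_mult coeff_eq_0)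
  qed
  have a_k: "a k \<noteq> 0" using k by (simp add: a_def coeff_monom_mult I_def)
  then have "k \<le> E" using a_0[of k] k by (force simp: I_def)
  have degW: "degree (monom 1 (N - l) * B l) \<le> W" if "l < N" for l
    using W_ge[of l] that degree_mult_le[of "monom 1 (N - l)" "B l"] 
    by (cases "B l = 0") (auto simp: I_def degree_monom_eq)
  have rel: "(\<Sum>l\<le>E. a l * (\<Prod>i<l. real (degree g) - real i)) = 0" if "g \<in> G" for g
  proof -
    define d where "d = degree g"
    have degd: "degree (monom 1 l * (pderiv ^^ l) g) \<le> d" for l
    proof (rule degree_le, intro allI impI)
      fix i assume "d < i"
      then show "coeff (monom 1 l * (pderiv ^^ l) g) i = 0"
        by (simp add: coeff_monom_mult_higher_pderiv d_def coeff_eq_0)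
    qed
    \<comment> \<open>Distributing x^N as x^(N - l) x^l makes every derivative diagonal; the
      coefficient of x^(W + d) is then the indicial relation.\<close>
    have "monom 1 N * (\<Sum>l<N. B l * (pderiv ^^ l) g)
        = (\<Sum>l<N. (monom 1 (N - l) * B l) * (monom 1 l * (pderiv ^^ l) g))"
      unfolding sum_distrib_left
    proof (intro sum.cong refl)
      fix l assume "l \<in> {..<N}"
      then have "monom 1 N = monom 1 (N - l) * monom (1::real) l"
        by (simp add: mult_monom)
      then show "monom 1 N * (B l * (pderiv ^^ l) g)
          = (monom 1 (N - l) * B l) * (monom 1 l * (pderiv ^^ l) g)"
        by (simp add: mult_ac)
    qed
    then have "0 = (\<Sum>l<N. coeff ((monom 1 (N - l) * B l) * (monom 1 l * (pderiv ^^ l) g)) (W + d))"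
      using sol[OF that] expand[of g] by (simp flip: coeff_sum)
    also have "\<dots> = (\<Sum>l<N. a l * ((\<Prod>i<l. real d - real i) * coeff g d))"
      using degW degd
      by (intro sum.cong refl)
        (simp add: coeff_mult_degree_le coeff_monom_mult_higher_pderiv a_def)
    also have "\<dots> = (\<Sum>l\<le>E. a l * ((\<Prod>i<l. real d - real i) * coeff g d))"
      using E(1) a_0 by (intro sum.mono_neutral_right) auto
    also have "\<dots> = (\<Sum>l\<le>E. a l * (\<Prod>i<l. real d - real i)) * coeff g d"
      by (simp add: sum_distrib_right mult.assoc)
    finally show ?thesis using sol[OF that] by (simp add: d_def)
  qed
  have "card (degree ` G) \<le> E"
    using rel by (intro card_falling_factorial_roots[where a = a, OF \<open>k \<le> E\<close> a_k]) auto
  then show ?thesis using inj by (simp add: card_image)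
qed

text \<open>
  If the determinant vanished, a differential operator of order less than \<open>N\<close> would annihilate all
  \<open>N\<close> functions \<open>exp (c i x) g i\<close>. Its symbol \<open>\<sigma>\<close> at infinity has degree less than \<open>N\<close>, while each
  exponent \<open>x\<close> is a root of \<open>\<sigma>\<close> whose multiplicity is at least the number of \<open>i\<close> with \<open>c i = x\<close>.
\<close>

lemma det_exp_deriv_nonzero:
  fixes c :: "nat \<Rightarrow> real" and g :: "nat \<Rightarrow> real poly"
  assumes nz: "\<And>i. i < N \<Longrightarrow> g i \<noteq> 0"
    and inj: "inj_on (\<lambda>i. (c i, degree (g i))) {..<N}"
  shows "Determinant.det (Matrix.mat N N (\<lambda>(i, j). exp_deriv (c i) j (g i))) \<noteq> 0"
proof
  let ?A = "Matrix.mat N N (\<lambda>(i, j). exp_deriv (c i) j (g i))"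
  assume "Determinant.det ?A = 0"
  \<comment> \<open>Polynomials form an integral domain, so the kernel vector can be taken with
    polynomial entries: the coefficients of the annihilating operator.\<close>
  then obtain v where v: "v \<in> carrier_vec N" "v \<noteq> 0\<^sub>v N" "?A *\<^sub>v v = 0\<^sub>v N"
    using det_0_iff_vec_prod_zero[of ?A N] by auto
  define b where "b = vec_index v"
  have sol: "(\<Sum>j<N. b j * exp_deriv (c i) j (g i)) = 0" if "i < N" for i
  proof -
    have "vec_index (?A *\<^sub>v v) i = 0" using v(3) that by simp
    then show ?thesis
      using that v(1) by (simp add: scalar_prod_def b_def mult.commute atLeast0LessThan)
  qed
  define J where "J = {j. j < N \<and> b j \<noteq> 0}"
  define M where "M = Max ((\<lambda>j. degree (b j)) ` J)"
  have "finite J" by (simp add: J_def)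
  have "J \<noteq> {}" using v(1,2) by (auto simp: J_def b_def vec_eq_iff)
  have deg: "degree (b j) \<le> M" if "j < N" for j
    using that \<open>finite J\<close> by (cases "b j = 0") (auto simp: M_def J_def intro!: Max_ge)
  have "M \<in> (\<lambda>j. degree (b j)) ` J"
    unfolding M_def using \<open>finite J\<close> \<open>J \<noteq> {}\<close> by (intro Max_in) auto
  then obtain j0 where j0: "j0 < N" "b j0 \<noteq> 0" "degree (b j0) = M" by (auto simp: J_def)
  \<comment> \<open>The symbol keeps from each operator coefficient only its part of maximal degree
    \<open>M\<close>.\<close>
  define \<sigma> where "\<sigma> = (\<Sum>j<N. monom (coeff (b j) M) j)"
  have coeff\<sigma>: "coeff \<sigma> j = (if j < N then coeff (b j) M else 0)" for j
    by (auto simp: \<sigma>_def coeff_sum)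
  have "\<sigma> \<noteq> 0" using coeff\<sigma>[of j0] j0 by auto
  have "degree \<sigma> < N"
    using j0(1) coeff\<sigma> by (intro degree_lessI) auto
  have class_le: "card {i. i < N \<and> c i = x} \<le> order x \<sigma>" for x
  proof -
    define t where "t = (\<lambda>l. \<Sum>j<N. coeff \<sigma> j * (real (j choose l) * x ^ (j - l)))"
    have \<sigma>: "\<sigma> = (\<Sum>l<N. smult (t l) ([:-x, 1:] ^ l))"
      unfolding t_def by (rule taylor_poly) fact
    have "\<exists>l<N. t l \<noteq> 0"
      using \<sigma> \<open>\<sigma> \<noteq> 0\<close> by (metis (no_types, lifting) lessThan_iff smult_0_left sum.neutral)
    then have ex: "\<exists>l. l < N \<and> t l \<noteq> 0" by blast
    \<comment> \<open>\<open>E\<close> indexes the first nonzero Taylor coefficient at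
      \<open>x\<close>, so it is the multiplicity of \<open>x\<close> as a root of \<sigma>.\<close>
    define E where "E = (LEAST l. l < N \<and> t l \<noteq> 0)"
    have E: "E < N" "t E \<noteq> 0" using LeastI_ex[OF ex] by (auto simp: E_def)
    have least: "E \<le> l" if "l < N" "t l \<noteq> 0" for l
      unfolding E_def using that by (intro Least_le) auto
    have "[:-x, 1:] ^ E dvd \<sigma>"
      unfolding \<sigma>
    proof (rule dvd_sum)
      fix l assume "l \<in> {..<N}"
      then show "[:-x, 1:] ^ E dvd smult (t l) ([:-x, 1:] ^ l)"
        using least[of l] by (cases "t l = 0") (auto intro: dvd_smult le_imp_power_dvd)
    qed
    then have "E \<le> order x \<sigma>" using \<open>\<sigma> \<noteq> 0\<close> by (simp add: order_divides)
    define K where "K = {i. i < N \<and> c i = x}"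
    have inj_deg: "inj_on (\<lambda>i. degree (g i)) K"
      using inj by (auto simp: inj_on_def K_def)
    have "card (g ` K) \<le> E"
    proof (rule card_exp_deriv_solutions_le[OF deg])
      show "(\<Sum>j<N. coeff (b j) M * (real (j choose E) * x ^ (j - E))) \<noteq> 0"
        using E(2) by (simp add: t_def coeff\<sigma>)
      show "inj_on degree (g ` K)"
        using inj_deg by (auto simp: inj_on_def)
    qed (use E nz sol in \<open>auto simp: K_def\<close>)
    moreover have "card (g ` K) = card K"
      using inj_deg by (intro card_image) (auto simp: inj_on_def)
    ultimately show ?thesis using \<open>E \<le> order x \<sigma>\<close> by (simp add: K_def)
  qed
  let ?C = "c ` {..<N}"
  have "N = (\<Sum>i<N. 1)" by simp
  also have "\<dots> = (\<Sum>x\<in>?C. \<Sum>i | i \<in> {..<N} \<and> c i = x. 1)"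
    by (rule sum.image_gen) simp
  also have "\<dots> \<le> (\<Sum>x\<in>?C. order x \<sigma>)"
    using class_le by (intro sum_mono) simp
  also have "\<dots> = (\<Sum>x \<in> ?C \<inter> {x. poly \<sigma> x = 0}. order x \<sigma>)"
    using \<open>\<sigma> \<noteq> 0\<close> by (intro sum.mono_neutral_right) (auto simp: order_root)
  also have "\<dots> \<le> (\<Sum>x | poly \<sigma> x = 0. order x \<sigma>)"
    by (intro sum_mono2 poly_roots_finite \<open>\<sigma> \<noteq> 0\<close>) auto
  also have "\<dots> \<le> degree \<sigma>" by (rule sum_order_le_degree) fact
  finally show False using \<open>degree \<sigma> < N\<close> by simp
qed

section \<open>Expansion of the determinant and degree bounds\<close>

lemma det_exp_deriv_expand:
  fixes c :: "nat \<Rightarrow> real" and g :: "nat \<Rightarrow> real poly"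
  shows "Determinant.det (Matrix.mat N N (\<lambda>(i, j). exp_deriv (c i) j (g i))) =
    (\<Sum>l \<in> {..<N} \<rightarrow>\<^sub>E {..<N}.
       smult (Determinant.det (Matrix.mat N N (\<lambda>(i, j). real (j choose l i) * c i ^ (j - l i))))
         (\<Prod>i<N. (pderiv ^^ l i) (g i)))"
proof -
  let ?S = "{\<pi>. \<pi> permutes {0..<N}}"
  let ?L = "{..<N} \<rightarrow>\<^sub>E {..<N}"
  let ?b = "\<lambda>i j l. real (j choose l) * c i ^ (j - l)"
  have less: "\<pi> i < N" if "\<pi> permutes {0..<N}" "i < N" for \<pi> i
    using that permutes_in_image[of \<pi> "{0..<N}" i] by simp
  have "Determinant.det (Matrix.mat N N (\<lambda>(i, j). exp_deriv (c i) j (g i))) =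
      (\<Sum>\<pi>\<in>?S. signof \<pi> * (\<Prod>i<N. exp_deriv (c i) (\<pi> i) (g i)))"
    unfolding Determinant.det_def
    by (auto simp: less atLeast0LessThan intro!: sum.cong prod.cong)
  also have "\<dots> = (\<Sum>\<pi>\<in>?S. \<Sum>l\<in>?L. smult (signof \<pi> * (\<Prod>i<N. ?b i (\<pi> i) (l i)))
      (\<Prod>i<N. (pderiv ^^ l i) (g i)))"
  proof (intro sum.cong refl)
    fix \<pi> assume "\<pi> \<in> ?S"
    then have "(\<Prod>i<N. exp_deriv (c i) (\<pi> i) (g i)) =
        (\<Prod>i<N. \<Sum>l<N. smult (?b i (\<pi> i) l) ((pderiv ^^ l) (g i)))"
      by (intro prod.cong refl exp_deriv_expand_less) (auto simp: less)
    \<comment> \<open>Each row chooses its order of differentiation \<open>l i\<close> independently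
      of the column, so the sum over permutations later collapses to a scalar determinant.\<close>
    also have "\<dots> = (\<Sum>l\<in>?L. \<Prod>i<N. smult (?b i (\<pi> i) (l i)) ((pderiv ^^ l i) (g i)))"
      by (rule prod_sum_PiE) auto
    finally show "signof \<pi> * (\<Prod>i<N. exp_deriv (c i) (\<pi> i) (g i)) =
        (\<Sum>l\<in>?L. smult (signof \<pi> * (\<Prod>i<N. ?b i (\<pi> i) (l i))) (\<Prod>i<N. (pderiv ^^ l i) (g i)))"
      by (simp add: sum_distrib_left prod_smult sign_def)
  qed
  also have "\<dots> = (\<Sum>l\<in>?L. \<Sum>\<pi>\<in>?S. smult (signof \<pi> * (\<Prod>i<N. ?b i (\<pi> i) (l i)))
      (\<Prod>i<N. (pderiv ^^ l i) (g i)))"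
    by (rule sum.swap)
  also have "\<dots> = (\<Sum>l\<in>?L. smult (\<Sum>\<pi>\<in>?S. signof \<pi> * (\<Prod>i<N. ?b i (\<pi> i) (l i)))
      (\<Prod>i<N. (pderiv ^^ l i) (g i)))"
    by (simp add: smult_sum)
  also have "\<dots> = (\<Sum>l\<in>?L. smult (Determinant.det (Matrix.mat N N (\<lambda>(i, j). ?b i j (l i))))
      (\<Prod>i<N. (pderiv ^^ l i) (g i)))"
    unfolding Determinant.det_def
    by (intro sum.cong refl arg_cong2[of _ _ _ _ smult])
      (auto simp: less atLeast0LessThan intro!: sum.cong prod.cong)
  finally show ?thesis .
qed

text \<open>Two rows with the same exponent and the same order coincide, so only choices injective
  in this sense survive the expansion.\<close>

lemma det_choose_eq_0:
  assumes "\<not> inj_on (\<lambda>i. (c i, l i)) {..<N}"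
  shows "Determinant.det (Matrix.mat N N (\<lambda>(i, j). real (j choose l i) * c i ^ (j - l i))) = 0"
proof -
  obtain i k where "i < N" "k < N" "i \<noteq> k" "c i = c k" "l i = l k"
    using assms by (auto simp: inj_on_def)
  then show ?thesis
    by (intro det_identical_rows[of _ N i k]) auto
qed

text \<open>Within a class of k rows with equal exponent the orders are distinct, so together they
  lower the degree by at least 0 + ... + (k - 1).\<close>

lemma degree_prod_higher_pderiv_le:
  fixes g :: "nat \<Rightarrow> real poly"
  assumes inj: "inj_on (\<lambda>i. (c i, l i)) A"
    and fin: "finite A" "finite X" "c ` A \<subseteq> X"
    and nz: "(\<Prod>i\<in>A. (pderiv ^^ l i) (g i)) \<noteq> 0"
  shows "degree (\<Prod>i\<in>A. (pderiv ^^ l i) (g i)) + (\<Sum>x\<in>X. \<Sum>{0..<card {i \<in> A. c i = x}})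
      \<le> (\<Sum>i\<in>A. degree (g i))"
proof -
  have nz: "(pderiv ^^ l i) (g i) \<noteq> 0" if "i \<in> A" for i
    using nz that fin(1) by auto
  have le: "l i \<le> degree (g i)" if "i \<in> A" for i
    using nz[OF that]
    by (rule contrapos_np) (auto intro!: poly_eqI simp: coeff_higher_pderiv coeff_eq_0)
  have "(\<Sum>x\<in>X. \<Sum>{0..<card {i \<in> A. c i = x}}) \<le> (\<Sum>x\<in>X. \<Sum>i\<in>{i \<in> A. c i = x}. l i)"
  proof (rule sum_mono)
    fix x
    let ?K = "{i \<in> A. c i = x}"
    have inj_l: "inj_on l ?K" using inj by (auto simp: inj_on_def)
    then have "\<Sum>{0..<card ?K} = \<Sum>{0..<card (l ` ?K)}" by (simp add: card_image)
    also have "\<dots> \<le> \<Sum>(l ` ?K)" by (rule card_sum_le_nat_sum)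
    also have "\<dots> = (\<Sum>i\<in>?K. l i)" using inj_l by (simp add: sum.reindex)
    finally show "\<Sum>{0..<card ?K} \<le> (\<Sum>i\<in>?K. l i)" .
  qed
  also have "\<dots> = (\<Sum>i\<in>A. l i)"
    using sum.group[OF fin, of l] by simp
  finally have "degree (\<Prod>i\<in>A. (pderiv ^^ l i) (g i)) + (\<Sum>x\<in>X. \<Sum>{0..<card {i \<in> A. c i = x}})
      \<le> (\<Sum>i\<in>A. degree ((pderiv ^^ l i) (g i))) + (\<Sum>i\<in>A. l i)"
    using nz by (simp add: degree_prod_eq_sum_degree)
  also have "\<dots> = (\<Sum>i\<in>A. degree (g i))"
    using le by (simp add: degree_higher_pderiv flip: sum.distrib)
  finally show ?thesis .
qed

subsection \<open>Exceptional Laguerre polynomials\<close>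

lemma wronskian_exp_poly_det:
  "wronskian (map (\<lambda>i x. exp (c i * x) * poly (g i) x) [0..<N]) x =
    exp ((\<Sum>i<N. c i) * x) *
      poly (Determinant.det (Matrix.mat N N (\<lambda>(i, j). exp_deriv (c i) j (g i)))) x"
proof -
  let ?S = "{\<pi>. \<pi> permutes {0..<N}}"
  have less: "\<pi> i < N" if "\<pi> permutes {0..<N}" "i < N" for \<pi> i
    using that permutes_in_image[of \<pi> "{0..<N}" i] by simp
  have "wronskian (map (\<lambda>i x. exp (c i * x) * poly (g i) x) [0..<N]) x =
      (\<Sum>\<pi>\<in>?S. signof \<pi> * (\<Prod>i = 0..<N. exp (c i * x) * poly (exp_deriv (c i) (\<pi> i) (g i)) x))"
    unfolding wronskian_def Determinant.det_def
    by (auto intro!: sum.cong prod.cong simp: higher_deriv_exp_poly exp_deriv_def less)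
  also have "\<dots> = exp ((\<Sum>i<N. c i) * x) *
      (\<Sum>\<pi>\<in>?S. signof \<pi> * (\<Prod>i = 0..<N. poly (exp_deriv (c i) (\<pi> i) (g i)) x))"
    by (simp add: prod.distrib sum_distrib_left sum_distrib_right exp_sum atLeast0LessThan mult_ac)
  also have "(\<Sum>\<pi>\<in>?S. signof \<pi> * (\<Prod>i = 0..<N. poly (exp_deriv (c i) (\<pi> i) (g i)) x)) =
      poly (Determinant.det (Matrix.mat N N (\<lambda>(i, j). exp_deriv (c i) j (g i)))) x"
    unfolding Determinant.det_def
    by (auto intro!: sum.cong prod.cong simp: poly_sum poly_prod less sign_def)
  finally show ?thesis .
qed

text \<open>
  \<open>D\<close> bounds the degrees of all cofactors of the last row of the determinant; a cofactor of
  the entry in column \<open>k\<close> multiplies the \<open>k\<close>-th derivative of the last Laguerre polynomial, and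
  \<open>x^(r - k)\<close> times that derivative is still orthogonal to low degrees.
\<close>

context
  fixes c :: "nat \<Rightarrow> real" and g :: "nat \<Rightarrow> real poly" and \<alpha> :: real and r s D :: nat
  assumes last: "g r = laguerre \<alpha> s"
    and D: "\<And>l. inj_on (\<lambda>i. (c i, l i)) {..<r} \<Longrightarrow> degree (\<Prod>i<r. (pderiv ^^ l i) (g i)) \<le> D"
begin

lemma degree_det_exp_deriv_le:
  "degree (Determinant.det (Matrix.mat (Suc r) (Suc r) (\<lambda>(i, j). exp_deriv (c i) j (g i)))) \<le> D + s"
  unfolding det_exp_deriv_expand
proof (intro degree_sum_le)
  fix l
  show "degree (smult (Determinant.det (Matrix.mat (Suc r) (Suc r)
        (\<lambda>(i, j). real (j choose l i) * c i ^ (j - l i))))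
      (\<Prod>i<Suc r. (pderiv ^^ l i) (g i))) \<le> D + s"
  proof (cases "inj_on (\<lambda>i. (c i, l i)) {..<Suc r}")
    case True
    then have "inj_on (\<lambda>i. (c i, l i)) {..<r}" by (rule inj_on_subset) auto
    from D[OF this] show ?thesis
      using degree_mult_le[of "\<Prod>i<r. (pderiv ^^ l i) (g i)" "(pderiv ^^ l r) (g r)"]
      by (auto simp: last degree_higher_pderiv mult.commute intro!: order_trans[OF degree_smult_le])
  qed (simp add: det_choose_eq_0)
qed (auto intro: finite_PiE)

lemma gamma_functional_det_exp_deriv:
  assumes "\<alpha> + real r > -1" and p: "degree p + D + r < s"
  shows "gamma_functional (\<alpha> + real r)
    (Determinant.det (Matrix.mat (Suc r) (Suc r) (\<lambda>(i, j). exp_deriv (c i) j (g i))) * p) = 0"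
proof -
  let ?a = "\<lambda>l. Determinant.det (Matrix.mat (Suc r) (Suc r)
    (\<lambda>(i, j). real (j choose l i) * c i ^ (j - l i)))"
  let ?L = "{..<Suc r} \<rightarrow>\<^sub>E {..<Suc r}"
  have "?a l * gamma_functional (\<alpha> + real r) ((\<Prod>i<Suc r. (pderiv ^^ l i) (g i)) * p) = 0"
    if "l \<in> ?L" for l
  proof (cases "inj_on (\<lambda>i. (c i, l i)) {..<Suc r}")
    case True
    then have "inj_on (\<lambda>i. (c i, l i)) {..<r}" by (rule inj_on_subset) auto
    from D[OF this] have "degree ((\<Prod>i<r. (pderiv ^^ l i) (g i)) * p) + r < s"
      using degree_mult_le[of "\<Prod>i<r. (pderiv ^^ l i) (g i)" p] p by linarith
    \<comment> \<open>The columns are numbered from 0 to \<open>r\<close>, which is the range of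
      derivatives of the last Laguerre polynomial covered by orthogonality.\<close>
    moreover have "l r \<le> r"
      using PiE_mem[OF that, of r] by auto
    ultimately have "gamma_functional (\<alpha> + real r)
        (((\<Prod>i<r. (pderiv ^^ l i) (g i)) * p) * (pderiv ^^ l r) (laguerre \<alpha> s)) = 0"
      using assms(1) by (intro gamma_functional_mult_pderiv_laguerre)
    then show ?thesis by (simp add: last mult_ac)
  qed (simp add: det_choose_eq_0)
  then show ?thesis
    unfolding det_exp_deriv_expand sum_distrib_right mult_smult_left
      gamma_functional_sum[OF assms(1)] gamma_functional_smult
    by (rule sum.neutral[rule_format])
qed

end

section \<open>Odd-order zeros and simple zeros\<close>

lemma finite_odd_order_roots:
  fixes P :: "real poly"
  assumes "P \<noteq> 0"
  shows "finite (positive_zeros P)" "{x. x > 0 \<and> odd (order x P)} \<subseteq> positive_zeros P"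
  using finite_subset[OF _ poly_roots_finite[OF assms], of "positive_zeros P"] assms
  by (auto simp: positive_zeros_def order_root elim: oddE)

lemma odd_order_roots_le_num_positive_zeros:
  assumes "P \<noteq> 0"
  shows "card {x. x > 0 \<and> odd (order x P)} \<le> num_positive_zeros P"
proof -
  have "card {x. x > 0 \<and> odd (order x P)} \<le> card (positive_zeros P)"
    using finite_odd_order_roots[OF assms] by (intro card_mono)
  also have "\<dots> = (\<Sum>x\<in>positive_zeros P. 1)" by simp
  also have "\<dots> \<le> num_positive_zeros P"
    unfolding num_positive_zeros_def using assms
    by (intro sum_mono) (auto simp: positive_zeros_def order_root Suc_le_eq)
  finally show ?thesis .
qed

text \<open>An odd order is 1 or at least 3. Crediting 2 to each simple zero makes every odd-order
  zero count at least 3, while all orders together sum to at most the degree.\<close>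

lemma odd_order_roots_le_num_simple_positive_zeros:
  assumes "P \<noteq> 0"
  shows "3 * card {x. x > 0 \<and> odd (order x P)} \<le> degree P + 2 * num_simple_positive_zeros P"
proof -
  define Z where "Z = {x. x > 0 \<and> odd (order x P)}"
  define S where "S = {x \<in> positive_zeros P. order x P = 1}"
  have Z: "finite Z" "Z \<subseteq> positive_zeros P"
    using finite_odd_order_roots[OF assms] by (auto simp: Z_def intro: finite_subset)
  have S: "S \<subseteq> Z" by (auto simp: S_def Z_def positive_zeros_def)
  have "3 * card Z = (\<Sum>x\<in>Z. 3)" by simp
  also have "\<dots> \<le> (\<Sum>x\<in>Z. order x P + (if x \<in> S then 2 else 0))"
  proof (rule sum_mono)
    fix x assume "x \<in> Z"
    then have "odd (order x P)" "x \<in> positive_zeros P" using Z(2) by (auto simp: Z_def)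
    then show "3 \<le> order x P + (if x \<in> S then 2 else 0)"
      by (cases "order x P = 1") (auto simp: S_def elim!: oddE)
  qed
  also have "\<dots> = (\<Sum>x\<in>Z. order x P) + 2 * card S"
    using Z(1) S by (simp add: sum.distrib sum.If_cases Int_absorb1)
  also have "(\<Sum>x\<in>Z. order x P) \<le> (\<Sum>x | poly P x = 0. order x P)"
    using Z by (intro sum_mono2 poly_roots_finite assms) (auto simp: positive_zeros_def)
  also have "\<dots> \<le> degree P" by (rule sum_order_le_degree[OF assms])
  finally show ?thesis by (simp add: Z_def S_def num_simple_positive_zeros_def)
qed

section \<open>Partitions and the rows of the determinant\<close>

lemma shifted_part_less:
  assumes "is_partition ps" "i < k" "k < length ps"
  shows "shifted_part ps (Suc k) < shifted_part ps (Suc i)"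
  using assms sorted_wrt_nth_less[of "(\<ge>)" ps i k]
  by (auto simp: is_partition_def shifted_part_def)

text \<open>The shifts run through 0, ..., \<open>length ps\<close> - 1; their total is exactly the
  loss of degree in \<open>degree_prod_higher_pderiv_le\<close>, so only the size of the partition
  remains.\<close>

lemma sum_shifted_part:
  "(\<Sum>i<length ps. shifted_part ps (Suc i)) = sum_list ps + \<Sum>{0..<length ps}"
proof -
  have "(\<Sum>i<length ps. shifted_part ps (Suc i)) = (\<Sum>i<length ps. ps ! i + (length ps - Suc i))"
    by (intro sum.cong refl) (auto simp: shifted_part_def)
  also have "\<dots> = sum_list ps + (\<Sum>i<length ps. length ps - Suc i)"
    unfolding sum.distrib by (simp add: sum_list_sum_nth atLeast0LessThan)
  also have "(\<Sum>i<length ps. length ps - Suc i) = \<Sum>{0..<length ps}"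
    using sum.nat_diff_reindex[of id "length ps"] by (simp add: atLeast0LessThan)
  finally show ?thesis .
qed

definition row_exponent :: "nat list \<Rightarrow> nat list \<Rightarrow> nat \<Rightarrow> real" where
  "row_exponent lam mu i = (if length lam \<le> i \<and> i < length lam + length mu then 1 else 0)"

definition row_poly :: "real \<Rightarrow> nat list \<Rightarrow> nat list \<Rightarrow> nat \<Rightarrow> nat \<Rightarrow> real poly" where
  "row_poly \<alpha> lam mu s i =
    (if i < length lam then laguerre \<alpha> (shifted_part lam (Suc i))
     else if i < length lam + length mu
       then laguerre \<alpha> (shifted_part mu (Suc (i - length lam))) \<circ>\<^sub>p [:0, -1:]
     else laguerre \<alpha> s)"

lemma exc_laguerre_eq_det:
  fixes lam mu :: "nat list"
  defines "r \<equiv> length lam + length mu"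
  shows "exc_laguerre \<alpha> lam mu n = Determinant.det (Matrix.mat (Suc r) (Suc r) (\<lambda>(i, j).
    exp_deriv (row_exponent lam mu i) j
      (row_poly \<alpha> lam mu (n + length lam - (sum_list lam + sum_list mu)) i)))"
proof (rule poly_ext)
  fix x
  define s where "s = n + length lam - (sum_list lam + sum_list mu)"
  have upt: "[1..<k + 1] = map Suc [0..<k]" for k
    by (simp add: map_Suc_upt)
  have *: "seed_functions \<alpha> lam mu @ [poly (laguerre \<alpha> s)] =
      map (\<lambda>i x. exp (row_exponent lam mu i * x) * poly (row_poly \<alpha> lam mu s i) x) [0..<Suc r]"
    by (intro nth_equalityI)
      (auto simp: seed_functions_def upt row_exponent_def row_poly_def r_def nth_append poly_pcompose
        fun_eq_iff simp del: upt_Suc One_nat_def add_Suc_right)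
  have "(\<Sum>i<Suc r. row_exponent lam mu i) = (\<Sum>i\<in>{length lam..<r}. 1)"
    unfolding r_def by (intro sum.mono_neutral_cong_right) (auto simp: row_exponent_def)
  then have sum: "(\<Sum>i<Suc r. row_exponent lam mu i) = real (length mu)"
    by (simp add: r_def)
  show "poly (exc_laguerre \<alpha> lam mu n) x = poly (Determinant.det (Matrix.mat (Suc r) (Suc r)
      (\<lambda>(i, j). exp_deriv (row_exponent lam mu i) j (row_poly \<alpha> lam mu
        (n + length lam - (sum_list lam + sum_list mu)) i)))) x"
    unfolding poly_exc_laguerre exc_laguerre_fun_def s_def[symmetric] * wronskian_exp_poly_det sum
    by (simp flip: exp_add mult.assoc)
qed

lemma degree_row_poly:
  "degree (row_poly \<alpha> lam mu s i) =
    (if i < length lam then shifted_part lam (Suc i)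
     else if i < length lam + length mu then shifted_part mu (Suc (i - length lam)) else s)"
  by (simp add: row_poly_def degree_pcompose)

lemma row_poly_nonzero: "row_poly \<alpha> lam mu s i \<noteq> 0"
  by (auto simp: row_poly_def pcompose_eq_0_iff)

lemma degree_prod_row_poly_le:
  fixes lam mu :: "nat list"
  defines "r \<equiv> length lam + length mu"
  assumes "inj_on (\<lambda>i. (row_exponent lam mu i, l i)) {..<r}"
  shows "degree (\<Prod>i<r. (pderiv ^^ l i) (row_poly \<alpha> lam mu s i)) \<le> sum_list lam + sum_list mu"
proof (cases "(\<Prod>i<r. (pderiv ^^ l i) (row_poly \<alpha> lam mu s i)) = 0")
  case False
  let ?K = "\<lambda>x. {i \<in> {..<r}. row_exponent lam mu i = x}"
  have "?K 0 = {..<length lam}" "?K 1 = {length lam..<r}"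
    by (auto simp: row_exponent_def r_def)
  then have "(\<Sum>x\<in>{0, 1}. \<Sum>{0..<card (?K x)}) = \<Sum>{0..<length lam} + \<Sum>{0..<length mu}"
    by (simp add: r_def)
  moreover have "(\<Sum>i<r. degree (row_poly \<alpha> lam mu s i)) =
      (\<Sum>i<length lam. shifted_part lam (Suc i)) + (\<Sum>i<length mu. shifted_part mu (Suc i))"
    using sum.atLeastLessThan_concat[of 0 "length lam" r "\<lambda>i. degree (row_poly \<alpha> lam mu s i)"]
      sum.shift_bounds_nat_ivl[of "\<lambda>i. degree (row_poly \<alpha> lam mu s i)" 0 "length lam" "length mu"]
    by (simp add: r_def degree_row_poly atLeast0LessThan add.commute)
  moreover have "degree (\<Prod>i<r. (pderiv ^^ l i) (row_poly \<alpha> lam mu s i))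
        + (\<Sum>x\<in>{0, 1}. \<Sum>{0..<card (?K x)}) \<le> (\<Sum>i<r. degree (row_poly \<alpha> lam mu s i))"
    using assms False
    by (intro degree_prod_higher_pderiv_le) (auto simp: row_exponent_def)
  ultimately show ?thesis by (simp add: sum_shifted_part)
qed (simp only: degree_0 le0)

text \<open>The exponent separates the rows of \<open>mu\<close> from the others, and shifted parts
  are distinct within a partition. The last row shares exponent 0 with those of \<open>lam\<close>,
  so \<open>s\<close> must avoid their degrees.\<close>

lemma inj_on_row_degrees:
  assumes "is_partition lam" "is_partition mu"
    and s: "\<And>i. i < length lam \<Longrightarrow> shifted_part lam (Suc i) \<noteq> s"
  shows "inj_on (\<lambda>i. (row_exponent lam mu i, degree (row_poly \<alpha> lam mu s i)))
    {..<Suc (length lam + length mu)}"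
proof (rule linorder_inj_onI)
  fix i k
  assume "i < k" "i \<in> {..<Suc (length lam + length mu)}" "k \<in> {..<Suc (length lam + length mu)}"
  moreover from this have "i - length lam < k - length lam \<and> k - length lam < length mu"
    if "length lam \<le> i" "k < length lam + length mu"
    using that by linarith
  ultimately show "(row_exponent lam mu i, degree (row_poly \<alpha> lam mu s i)) \<noteq>
      (row_exponent lam mu k, degree (row_poly \<alpha> lam mu s k))"
    using shifted_part_less[OF assms(1), of i k] s[of i]
      shifted_part_less[OF assms(2), of "i - length lam" "k - length lam"]
    by (auto simp: row_exponent_def degree_row_poly)
qed auto

text \<open>Adding \<open>length lam\<close> to both sides of the excluded equations turns them into
  coincidences of \<open>s\<close> with a shifted part; the inequality prevents truncation.\<close>

lemma degree_sequence_index: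
  assumes "n \<in> degree_sequence lam mu"
  defines "s \<equiv> n + length lam - (sum_list lam + sum_list mu)"
  shows "s + sum_list lam + sum_list mu = n + length lam"
    and "\<And>i. i < length lam \<Longrightarrow> shifted_part lam (Suc i) \<noteq> s"
proof -
  show s: "s + sum_list lam + sum_list mu = n + length lam"
    using assms by (auto simp: degree_sequence_def)
  show "shifted_part lam (Suc i) \<noteq> s" if "i < length lam" for i
  proof
    assume *: "shifted_part lam (Suc i) = s"
    have "Suc i \<in> {1..length lam}" using that by simp
    then have "int n - int (sum_list lam) - int (sum_list mu) \<noteq> int (lam ! i) - int (Suc i)"
      using assms(1) unfolding degree_sequence_def by fastforce
    with * s that show False by (simp add: shifted_part_def)
  qed
qed

lemma exc_laguerre_zeros:
  assumes "is_partition lam" "is_partition mu"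
    and "\<alpha> + real (length lam + length mu) > -1"
    and n: "n \<in> degree_sequence lam mu"
  shows "int n - 2 * (int (sum_list lam) + int (sum_list mu)) - int (length mu)
      \<le> int (num_positive_zeros (exc_laguerre \<alpha> lam mu n))" (is ?bound)
    and "n \<le> num_simple_positive_zeros (exc_laguerre \<alpha> lam mu n)
        + 2 * (length lam + length mu) + 3 * (sum_list lam + sum_list mu)" (is ?simple)
proof -
  define r where "r = length lam + length mu"
  define D where "D = sum_list lam + sum_list mu"
  define s where "s = n + length lam - (sum_list lam + sum_list mu)"
  define P where "P = exc_laguerre \<alpha> lam mu n"
  let ?c = "row_exponent lam mu" and ?g = "row_poly \<alpha> lam mu s"
  note index = degree_sequence_index[OF n, folded s_def]
  have P: "P = Determinant.det (Matrix.mat (Suc r) (Suc r) (\<lambda>(i, j). exp_deriv (?c i) j (?g i)))"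
    unfolding P_def r_def s_def by (rule exc_laguerre_eq_det)
  have last: "?g r = laguerre \<alpha> s" by (simp add: row_poly_def r_def)
  have D: "degree (\<Prod>i<r. (pderiv ^^ l i) (?g i)) \<le> D" if "inj_on (\<lambda>i. (?c i, l i)) {..<r}" for l
    using that unfolding r_def D_def by (rule degree_prod_row_poly_le)
  have "P \<noteq> 0"
    unfolding P r_def using inj_on_row_degrees[OF assms(1,2) index(2)]
    by (intro det_exp_deriv_nonzero) (auto simp: row_poly_nonzero)
  have degP: "degree P \<le> D + s"
    unfolding P by (rule degree_det_exp_deriv_le[OF last D])
  have "s - r - D \<le> card {x. x > 0 \<and> odd (order x P)}"
  proof (rule card_odd_order_roots[OF _ \<open>P \<noteq> 0\<close>])
    show "\<alpha> + real r > -1" using assms(3) by (simp add: r_def)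
    then show "gamma_functional (\<alpha> + real r) (P * p) = 0" if "degree p < s - r - D" for p
      unfolding P using that by (intro gamma_functional_det_exp_deriv[OF last D]) auto
  qed
  then have card: "s \<le> r + D + card {x. x > 0 \<and> odd (order x P)}" by simp
  \<comment> \<open>Here s - r - D equals n - 2 D - \<open>length mu\<close>.\<close>
  show ?bound
    using card odd_order_roots_le_num_positive_zeros[OF \<open>P \<noteq> 0\<close>] index(1)
    unfolding P_def[symmetric] by (simp add: r_def D_def)
  \<comment> \<open>With S simple zeros, 3 (s - r - D) \<le> D + s + 2 S, so s \<le> S + 2 r + 2 D
    after rounding up; then n \<le> s + D.\<close>
  show ?simple
    using card odd_order_roots_le_num_simple_positive_zeros[OF \<open>P \<noteq> 0\<close>] degP index(1)
    unfolding P_def[symmetric] by (simp add: r_def D_def)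
qed

theorem theorem6p2:
  fixes \<alpha> :: real and lam mu :: "nat list"
  assumes "is_partition lam" and "is_partition mu"
    and "\<alpha> + real (length lam + length mu) > -1"
  shows "(\<forall>n \<in> degree_sequence lam mu.
            int n - 2 * (int (sum_list lam) + int (sum_list mu)) - int (length mu)
              \<le> int (num_positive_zeros (exc_laguerre \<alpha> lam mu n))) \<and>
         filterlim (\<lambda>n. num_simple_positive_zeros (exc_laguerre \<alpha> lam mu n)) at_top
           (inf sequentially (principal (degree_sequence lam mu)))"
proof (intro conjI ballI)
  show "filterlim (\<lambda>n. num_simple_positive_zeros (exc_laguerre \<alpha> lam mu n)) at_top
      (inf sequentially (principal (degree_sequence lam mu)))"
    unfolding filterlim_at_top eventually_inf_principal
  proof
    fix m
    show "\<forall>\<^sub>F n in sequentially. n \<in> degree_sequence lam mu \<longrightarrow>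
        m \<le> num_simple_positive_zeros (exc_laguerre \<alpha> lam mu n)"
      using eventually_ge_at_top[of "m + 2 * (length lam + length mu) + 3 * (sum_list lam + sum_list mu)"]
    proof eventually_elim
      case (elim n)
      then show ?case using exc_laguerre_zeros(2)[OF assms, of n] by linarith
    qed
  qed
qed (rule exc_laguerre_zeros(1)[OF assms])

end
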